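(* Let $m\ge 0$ and $p_1,\ldots,p_m\ge 3$ be integers, let $G\in\mathrm{CP}(2:p_1,\ldots,p_m)$ and $n=|V(G)|$. Then \[\det(\mathcal{D}(G))=(-1)^{n-1}\Big(1+\sum_{k\text{ odd}}(p_k-2)\Big)\Big(1+\sum_{k\text{ even}}(p_k-2)\Big)\] and $\operatorname{inertia}(\mathcal{D}(G))=(1,n-1,0)$.
   Context: A sequence of integers $q_1,\ldots,q_n$ ($n\ge 2$) is non-leaping if $q_1=0$, $q_2=1$, and $2\le q_k\le q_{k-1}+1$ for $k=3,\ldots,n$. Set $b_k=k-q_k+1$ for $k\ge 3$. A neighborhood sequence of $s$ is a sequence of sets $W_1=\varnothing$, $W_2=\{1\}$, and for $k\ge3$, $W_k=\{a_k\}\cup\{b_k,\ldots,k-1\}$ where $a_k\in W_{k-1}$ and $a_k<b_k$. Its graph has vertex set $\{1,\ldots,n\}$ with vertex $k$ joined to every vertex of $W_k$. $\mathrm{CP}(s)$ is the family of graphs of all neighborhood sequences of $s$. For integers $p_1,\ldots,p_m\ge3$, $2:p_1,\ldots,p_m$ denotes the non-leaping sequence $0,1,2,3,\ldots,p_1-1,2,3,\ldots,p_2-1,\ldots,2,3,\ldots,p_m-1$ (for $m=0$ it is $0,1$). $\mathcal{D}(G)$ is the distance matrix; the inertia of a symmetric matrix is the triple (number of positive, negative, zero eigenvalues). Sums over $k$ odd/even range over $k\in\{1,\ldots,m\}$. *)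

theory Defs
  imports
    "Graph_Theory.Pair_Digraph"
    "Graph_Theory.Shortest_Path"
    "Jordan_Normal_Form.Char_Poly"
    "HOL-Computational_Algebra.Polynomial"
begin

text \<open>
  A sequence $q_1, \ldots, q_n$ is a list \<open>s\<close>, and \<open>term_of s k\<close> is $q_k$, counted from 1.
  Natural numbers suffice as entries, since the conditions below force $q_k \geq 0$.
\<close>

definition term_of :: "nat list \<Rightarrow> nat \<Rightarrow> nat" where
  "term_of s k = s ! (k - 1)"

definition non_leaping :: "nat list \<Rightarrow> bool" where
  "non_leaping s \<longleftrightarrow>
     2 \<le> length s \<and> term_of s 1 = 0 \<and> term_of s 2 = 1 \<and>
     (\<forall>k\<in>{3..length s}. 2 \<le> term_of s k \<and> term_of s k \<le> term_of s (k - 1) + 1)"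

text \<open>
  $b_k = k - q_k + 1$. In a non-leaping sequence $q_k \leq k - 1$, so the subtraction
  on the natural numbers is exact.
\<close>

definition b_index :: "nat list \<Rightarrow> nat \<Rightarrow> nat" where
  "b_index s k = k + 1 - term_of s k"

text \<open>Only the values of \<open>W\<close> at $1, \ldots, n$ are relevant.\<close>

definition neighborhood_seq :: "nat list \<Rightarrow> (nat \<Rightarrow> nat set) \<Rightarrow> bool" where
  "neighborhood_seq s W \<longleftrightarrow>
     W 1 = {} \<and> W 2 = {1} \<and>
     (\<forall>k\<in>{3..length s}.
        \<exists>a\<in>W (k - 1). a < b_index s k \<and> W k = {a} \<union> {b_index s k..k - 1})"

text \<open>An undirected edge is represented by its two opposite arcs.\<close>

definition graph_of :: "nat \<Rightarrow> (nat \<Rightarrow> nat set) \<Rightarrow> nat pair_pre_digraph" where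
  "graph_of n W =
     \<lparr> pverts = {1..n},
       parcs = {(k, i) |k i. k \<in> {1..n} \<and> i \<in> W k} \<union> {(i, k) |i k. k \<in> {1..n} \<and> i \<in> W k} \<rparr>"

definition CP :: "nat list \<Rightarrow> nat pair_pre_digraph set" where
  "CP s = {graph_of (length s) W |W. neighborhood_seq s W}"

text \<open>
  \<open>two_colon [p\<^sub>1, \<dots>, p\<^sub>m]\<close> is the sequence
  $0, 1, 2, \ldots, p_1 - 1, \ldots, 2, \ldots, p_m - 1$.
\<close>

definition two_colon :: "nat list \<Rightarrow> nat list" where
  "two_colon ps = [0, 1] @ concat (map (\<lambda>p. [2..<p]) ps)"

text \<open>
  The distance is the least cost of a walk when every arc costs 1. It is an extended real,
  infinite exactly between different components; the graphs in \<open>CP\<close> are connected.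
\<close>

definition graph_dist :: "'a pair_pre_digraph \<Rightarrow> 'a \<Rightarrow> 'a \<Rightarrow> real" where
  "graph_dist G u v = real_of_ereal (wf_digraph.\<mu> (with_proj G) (\<lambda>_. 1) u v)"

text \<open>For graphs with vertex set $\{1, \ldots, n\}$; matrix indices start at 0.\<close>

definition distance_matrix :: "nat pair_pre_digraph \<Rightarrow> real mat" where
  "distance_matrix G =
     mat (card (pverts G)) (card (pverts G)) (\<lambda>(i, j). graph_dist G (i + 1) (j + 1))"

text \<open>
  The eigenvalues of a real symmetric matrix are all real, hence they are,
  with multiplicity, the real roots of the characteristic polynomial.
\<close>

definition inertia :: "real mat \<Rightarrow> nat \<times> nat \<times> nat" where
  "inertia A =
     (let E = proots (char_poly A)
      in (size {#x \<in># E. x > 0#}, size {#x \<in># E. x < 0#}, size {#x \<in># E. x = 0#}))"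

lemma term_of_bounds:
  assumes "non_leaping s" "2 \<le> k" "k \<le> length s"
  shows "1 \<le> term_of s k \<and> term_of s k \<le> k - 1"
  using assms(2,3)
proof (induction k)
  case 0
  then show ?case by simp
next
  case (Suc k)
  show ?case
  proof (cases "k = 1")
    case True
    then show ?thesis using assms(1) by (simp add: non_leaping_def numeral_2_eq_2)
  next
    case False
    then have "Suc k \<in> {3..length s}" using Suc.prems by auto
    then have "2 \<le> term_of s (Suc k) \<and> term_of s (Suc k) \<le> term_of s (Suc k - 1) + 1"
      using assms(1) unfolding non_leaping_def by blast
    moreover have "term_of s k \<le> k - 1" using Suc False by auto
    ultimately show ?thesis using Suc.prems False by (simp, linarith)
  qed
qed

lemma neighborhood_seq_subset:
  assumes s: "non_leaping s" and W: "neighborhood_seq s W" and k: "1 \<le> k" "k \<le> length s"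
  shows "W k \<subseteq> {1..<k}"
  using k
proof (induction k)
  case 0
  then show ?case by simp
next
  case (Suc k)
  consider "k = 0" | "k = 1" | "k \<ge> 2" by linarith
  then show ?case
  proof cases
    case 3
    then have k3: "Suc k \<in> {3..length s}" using Suc.prems by auto
    then obtain a where a: "a \<in> W (Suc k - 1)" "W (Suc k) = {a} \<union> {b_index s (Suc k)..Suc k - 1}"
      using W unfolding neighborhood_seq_def by blast
    have "a \<in> {1..<k}" using Suc 3 a by auto
    moreover have "1 \<le> b_index s (Suc k)"
      using term_of_bounds[OF s, of "Suc k"] k3 by (auto simp: b_index_def)
    ultimately show ?thesis using a by auto
  qed (use W in \<open>simp_all add: neighborhood_seq_def numeral_2_eq_2\<close>)
qed

lemma CP_pair_graph:
  assumes "non_leaping s" "G \<in> CP s"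
  shows "pair_graph G"
proof -
  obtain W where W: "neighborhood_seq s W" and G: "G = graph_of (length s) W"
    using assms(2) by (auto simp: CP_def)
  have sub: "W k \<subseteq> {1..<k}" if "k \<in> {1..length s}" for k
    using neighborhood_seq_subset[OF assms(1) W] that by simp
  have arcs: "parcs G \<subseteq> {1..length s} \<times> {1..length s}" "\<And>e. e \<in> parcs G \<Longrightarrow> fst e \<noteq> snd e"
    using sub by (fastforce simp: G graph_of_def)+
  have V: "pverts G = {1..length s}" by (simp add: G graph_of_def)
  have "sym (parcs G)" by (auto simp: G graph_of_def sym_def)
  moreover have "finite (parcs G)" using arcs(1) by (rule finite_subset) simp
  ultimately show ?thesis
    using arcs V by unfold_locales (auto simp: symmetric_def)
qed

lemma CP_nonempty:
  assumes s: "non_leaping s"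
  shows "CP s \<noteq> {}"
proof -
  define W where "W k = (if k \<le> 1 then {} else if k = 2 then {1} else {1} \<union> {b_index s k..k - 1})"
    for k :: nat
  have "neighborhood_seq s W"
    unfolding neighborhood_seq_def
  proof (intro conjI ballI)
    fix k assume k: "k \<in> {3..length s}"
    then have "1 < b_index s k"
      using term_of_bounds[OF s, of k] by (auto simp: b_index_def)
    moreover have "1 \<in> W (k - 1)" "W k = {1} \<union> {b_index s k..k - 1}"
      using k by (auto simp: W_def)
    ultimately show "\<exists>a\<in>W (k - 1). a < b_index s k \<and> W k = {a} \<union> {b_index s k..k - 1}"
      by blast
  qed (auto simp: W_def)
  then show ?thesis by (auto simp: CP_def)
qed

lemma non_leaping_two_colon:
  assumes "\<And>p. p \<in> set ps \<Longrightarrow> 3 \<le> p"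
  shows "non_leaping (two_colon ps)"
  using assms
proof (induction ps rule: rev_induct)
  case Nil
  show ?case by (simp add: two_colon_def non_leaping_def term_of_def)
next
  case (snoc p ps)
  let ?s = "two_colon ps"
  have s: "non_leaping ?s" using snoc by auto
  have eq: "two_colon (ps @ [p]) = ?s @ [2..<p]" by (simp add: two_colon_def)
  have "2 \<le> length ?s" by (simp add: two_colon_def)
  have "2 \<le> term_of (?s @ [2..<p]) k \<and>
      term_of (?s @ [2..<p]) k \<le> term_of (?s @ [2..<p]) (k - 1) + 1"
    if k: "k \<in> {3..length (?s @ [2..<p])}" for k
  proof -
    consider "k \<le> length ?s" | "k = length ?s + 1" | "k > length ?s + 1" by linarith
    then show ?thesis
    proof cases
      case 1
      then have "k \<in> {3..length ?s}" using k by auto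
      then have "2 \<le> term_of ?s k \<and> term_of ?s k \<le> term_of ?s (k - 1) + 1"
        using s unfolding non_leaping_def by blast
      then show ?thesis using 1 k by (auto simp: term_of_def nth_append)
    next
      case 2
      then have "1 \<le> term_of ?s (length ?s)"
        using term_of_bounds[OF s, of "length ?s"] \<open>2 \<le> length ?s\<close> by auto
      then show ?thesis using 2 k \<open>2 \<le> length ?s\<close> by (auto simp: term_of_def nth_append)
    next
      case 3
      then show ?thesis using k by (auto simp: term_of_def nth_append)
    qed
  qed
  then show ?case
    using s \<open>2 \<le> length ?s\<close> unfolding non_leaping_def eq
    by (auto simp: term_of_def nth_append)
qed

end

theory Submission
  imports Defs "Jordan_Normal_Form.Schur_Decomposition"
begin

text \<open>
  Vertex \<open>k\<close> has a parent \<open>r k\<close>: the vertex \<open>a\<^sub>k\<close> if \<open>k\<close> opens a block (\<open>q\<^sub>k = 2\<close>), and \<open>k - 1\<close> otherwise.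
  Let \<open>H\<close> consist of \<open>2\<close> and the vertices of the even blocks, put \<open>S 1 = H\<close>, and obtain \<open>S k\<close> from
  \<open>S (r k)\<close> by exchanging the elements \<open>k - 1\<close> and \<open>k\<close>. Then \<open>dist u v = |S u - S v|\<close>. With \<open>X\<close> the
  0/1 matrix whose rows are the sets \<open>S u\<close> and \<open>Y\<close> its complement, the distance matrix is
  \<open>X Y\<^sup>T\<close>. Subtracting parent rows leaves one full row and the rows \<open>\<plusminus>(e\<^sub>k - e\<^sub>k\<^sub>-\<^sub>1)\<close>, so up to sign
  the determinants of \<open>X\<close> and \<open>Y\<close> are \<open>|H|\<close> and \<open>n - |H|\<close>; these are the two factors.

  On vectors \<open>x\<close> with coordinate sum \<open>0\<close> the quadratic form is \<open>-|X\<^sup>T x|\<^sup>2\<close>, hence negative definite. Two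
  positive eigenvalues would yield a plane on which the form is positive, and such a plane meets
  that hyperplane. So at most one eigenvalue is positive, and the sign of the determinant does the rest.
\<close>

section \<open>Real symmetric matrices\<close>

text \<open>The product \<open>v \<bullet>c v\<close> is scaled by \<open>z\<close> when
  \<open>?C\<close> acts on the first factor and, as \<open>A\<close> is real, by
  \<open>cnj z\<close> when it acts on the second. Symmetry makes the two results equal.\<close>

lemma real_symmetric_eigenvalue_complex_real:
  fixes A :: "real mat" and z :: complex
  assumes A: "A \<in> carrier_mat n n" and sym: "A\<^sup>T = A"
    and z: "eigenvalue (map_mat complex_of_real A) z"
  shows "z \<in> \<real>"
proof -
  let ?C = "map_mat complex_of_real A"
  have C: "?C \<in> carrier_mat n n" using A by simp
  have "?C\<^sup>T = map_mat complex_of_real (A\<^sup>T)" by (rule eq_matI) auto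
  then have CT: "?C\<^sup>T = ?C" using sym by simp
  obtain v where v: "v \<in> carrier_vec n" "v \<noteq> 0\<^sub>v n" "?C *\<^sub>v v = z \<cdot>\<^sub>v v"
    using z C unfolding eigenvalue_def eigenvector_def by auto
  have conj: "conjugate (?C *\<^sub>v v) = ?C *\<^sub>v conjugate v"
    using A v(1) by (intro eq_vecI) (auto simp: scalar_prod_def conjugate_complex_def)
  have "z * (v \<bullet>c v) = (?C *\<^sub>v v) \<bullet> conjugate v"
    using v by simp
  also have "\<dots> = v \<bullet> (?C *\<^sub>v conjugate v)"
    using transpose_vec_mult_scalar[OF C _ v(1), of "conjugate v"] v(1) C CT
    by (metis carrier_vec_conjugate comm_scalar_prod mult_mat_vec_carrier)
  also have "\<dots> = cnj z * (v \<bullet>c v)"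
    using v by (simp add: conj[symmetric] conjugate_smult_vec conjugate_complex_def)
  finally have "z = cnj z"
    using v conjugate_square_eq_0_vec[OF v(1)] by simp
  then show ?thesis by (simp add: complex_is_Real_iff complex_eq_iff)
qed

text \<open>All complex roots are real by the preceding lemma, so the complex factorization is the
  image of a real one, and embedding the coefficients is injective.\<close>

lemma real_symmetric_char_poly_splits:
  fixes A :: "real mat"
  assumes A: "A \<in> carrier_mat n n" and sym: "A\<^sup>T = A"
  obtains es where "char_poly A = (\<Prod>e\<leftarrow>es. [:- e, 1:])" "length es = n"
proof -
  interpret poly_hom: map_poly_inj_idom_hom complex_of_real ..
  let ?C = "map_mat complex_of_real A"
  have C: "?C \<in> carrier_mat n n" using A by simp
  obtain as where as: "char_poly ?C = (\<Prod>a\<leftarrow>as. [:- a, 1:])" "length as = n"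
    using char_poly_factorized[OF C] by auto
  have real: "a \<in> \<real>" if "a \<in> set as" for a
  proof -
    have "poly (char_poly ?C) a = 0"
      using that by (auto simp: as(1) poly_prod_list prod_list_zero_iff image_iff)
    then show ?thesis
      using real_symmetric_eigenvalue_complex_real[OF A sym] eigenvalue_root_char_poly[OF C]
      by blast
  qed
  have "map_poly complex_of_real (char_poly A) = (\<Prod>a\<leftarrow>as. [:- a, 1:])"
    using of_real_hom.char_poly_hom[OF A] as(1) by metis
  also have "\<dots> = (\<Prod>a\<leftarrow>map Re as. [:- of_real a, 1:])"
    using real by (auto intro!: arg_cong[where f = prod_list])
  also have "\<dots> = map_poly complex_of_real (\<Prod>a\<leftarrow>map Re as. [:- a, 1:])"
    by (simp add: poly_hom.hom_prod_list of_real_hom.map_poly_pCons_hom comp_def)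
  finally have "char_poly A = (\<Prod>a\<leftarrow>map Re as. [:- a, 1:])"
    by (rule poly_hom.injectivity)
  then show ?thesis using as(2) that by (metis length_map)
qed

lemma proots_prod_list_linear:
  "proots (\<Prod>e\<leftarrow>es. [:- e, 1:]) = mset (es :: 'a :: idom list)"
proof (induction es)
  case (Cons e es)
  have "(\<Prod>e\<leftarrow>es. [:- e, 1:]) \<noteq> 0" by (auto simp: prod_list_zero_iff)
  then show ?case using Cons by (simp add: proots_mult del: mult_pCons_left)
qed simp

text \<open>Schur triangularization puts the roots on the diagonal of a similar matrix.\<close>

lemma det_eq_prod_list_roots:
  fixes A :: "'a :: conjugatable_ordered_field mat"
  assumes A: "A \<in> carrier_mat n n" and es: "char_poly A = (\<Prod>e\<leftarrow>es. [:- e, 1:])"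
  shows "det A = prod_list es"
proof -
  obtain B P Q where "schur_decomposition A es = (B, P, Q)" by (metis prod_cases3)
  from schur_decomposition[OF A es this]
  have B: "similar_mat_wit A B P Q" "upper_triangular B" "diag_mat B = es" by auto
  then have "B \<in> carrier_mat n n" using similar_mat_witD2[OF A] by blast
  then show ?thesis
    using det_similar[of A B] det_upper_triangular[OF B(2)] B by (auto simp: similar_mat_def)
qed

lemma scalar_prod_self_pos:
  fixes v :: "real vec"
  assumes "v \<in> carrier_vec n" "v \<noteq> 0\<^sub>v n"
  shows "v \<bullet> v > 0"
proof -
  have "conjugate v = v" by (rule eq_vecI) auto
  then show ?thesis using conjugate_square_greater_0_vec[OF assms(1)] assms(2) by simp
qed

text \<open>A Schur decomposition with \<open>l\<close> and \<open>m\<close> listed first stands in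
  for the spectral theorem: two columns of \<open>P\<close> span an invariant plane, in which
  symmetry yields an orthogonal pair of eigenvectors, also when \<open>l = m\<close>. Some nonzero
  vector of this plane is orthogonal to \<open>w\<close>.\<close>

lemma two_positive_roots_imp_nonneg:
  fixes A :: "real mat" and w :: "real vec"
  assumes A: "A \<in> carrier_mat n n" and sym: "A\<^sup>T = A" and w: "w \<in> carrier_vec n"
    and cp: "char_poly A = (\<Prod>e\<leftarrow>l # m # es. [:- e, 1:])" and pos: "l > 0" "m > 0"
  obtains x where "x \<in> carrier_vec n" "x \<noteq> 0\<^sub>v n" "w \<bullet> x = 0" "x \<bullet> (A *\<^sub>v x) \<ge> 0"
proof -
  obtain B P Q where "schur_decomposition A (l # m # es) = (B, P, Q)" by (metis prod_cases3)
  from schur_decomposition[OF A cp this]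
  have sim: "similar_mat_wit A B P Q" and ut: "upper_triangular B" and diag: "diag_mat B = l # m # es"
    by auto
  note D = similar_mat_witD2[OF A sim]
  have n: "n = Suc (Suc (length es))" using arg_cong[OF diag, of length] D by (simp add: diag_mat_def)
  have entries: "B $$ (0, 0) = l" "B $$ (1, 1) = m" "B $$ (1, 0) = 0"
    using diag D ut n by (auto simp: diag_mat_def upt_conv_Cons simp del: upt_Suc)
  have n01: "0 < n" "1 < n" using n by auto
  have AP: "A * P = P * B"
  proof -
    have "A * P = P * B * Q * P" using D by simp
    also have "\<dots> = P * B * (Q * P)" using D by (intro assoc_mult_mat) auto
    finally show ?thesis using D by simp
  qed
  have PB: "col (P * B) j = A *\<^sub>v col P j" if "j < n" for j
    using that D AP by (metis col_mult2)
  define u where "u = col P 0"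
  define v where "v = col P 1"
  have u: "u \<in> carrier_vec n" and v: "v \<in> carrier_vec n" using D by (auto simp: u_def v_def)
  \<comment> \<open>Triangularity leaves columns 0 and 1 of \<open>B\<close> supported on rows 0 and
    1, so the first two columns of \<open>P\<close> span an invariant plane.\<close>
  have Bcol: "(\<Sum>i = 0..<n. P $$ (k, i) * B $$ (i, j)) = (\<Sum>i\<in>{0, 1}. P $$ (k, i) * B $$ (i, j))"
    if "j \<le> 1" for j k
  proof (rule sum.mono_neutral_right)
    show "\<forall>i\<in>{0..<n} - {0, 1}. P $$ (k, i) * B $$ (i, j) = 0"
    proof
      fix i assume "i \<in> {0..<n} - {0, 1}"
      then have "B $$ (i, j) = 0" using ut D that unfolding upper_triangular_def by auto
      then show "P $$ (k, i) * B $$ (i, j) = 0" by simp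
    qed
  qed (use n in auto)
  have Au: "A *\<^sub>v u = l \<cdot>\<^sub>v u"
  proof -
    have "A *\<^sub>v u = col (P * B) 0" using PB n by (simp add: u_def)
    also have "\<dots> = l \<cdot>\<^sub>v u"
      using D n01 entries by (intro eq_vecI) (auto simp: u_def scalar_prod_def Bcol)
    finally show ?thesis .
  qed
  define b where "b = B $$ (0, 1)"
  have Av: "A *\<^sub>v v = b \<cdot>\<^sub>v u + m \<cdot>\<^sub>v v"
  proof -
    have "A *\<^sub>v v = col (P * B) 1" using PB n by (simp add: v_def)
    also have "\<dots> = b \<cdot>\<^sub>v u + m \<cdot>\<^sub>v v"
      using D n01 entries by (intro eq_vecI) (auto simp: u_def v_def b_def scalar_prod_def Bcol)
    finally show ?thesis .
  qed
  \<comment> \<open>\<open>Q\<close> inverts \<open>P\<close> and separates its columns; this shows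
    that \<open>u\<close> and later \<open>v'\<close> are nonzero.\<close>
  have Q: "Q *\<^sub>v col P j = unit_vec n j" if "j < n" for j
    using that D by (metis col_mult2 col_one)
  have Q0: "Q *\<^sub>v 0\<^sub>v n = 0\<^sub>v n" using D by (intro eq_vecI) auto
  have "u \<noteq> 0\<^sub>v n"
  proof
    assume "u = 0\<^sub>v n"
    then have "unit_vec n 0 = (0\<^sub>v n :: real vec)" using Q[of 0] Q0 n01 by (simp add: u_def)
    then show False using n by (metis index_unit_vec(1) index_zero_vec(1) zero_less_Suc zero_neq_one)
  qed
  then have uu: "u \<bullet> u > 0" using u by (blast intro: scalar_prod_self_pos)
  \<comment> \<open>Gram-Schmidt coefficient making \<open>v'\<close> orthogonal to
    \<open>u\<close>.\<close>
  define c where "c = - (u \<bullet> v) / (u \<bullet> u)"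
  define v' where "v' = v + c \<cdot>\<^sub>v u"
  have v': "v' \<in> carrier_vec n" using u v by (simp add: v'_def)
  have uv': "u \<bullet> v' = 0"
    using u v uu by (simp add: v'_def c_def scalar_prod_add_distrib[OF u v])
  have "v' \<noteq> 0\<^sub>v n"
  proof
    assume "v' = 0\<^sub>v n"
    then have "Q *\<^sub>v v' = 0\<^sub>v n" using Q0 by simp
    moreover have "Q *\<^sub>v v' = unit_vec n 1 + c \<cdot>\<^sub>v unit_vec n 0"
      using D u v n Q[of 0] Q[of 1]
      by (simp add: v'_def u_def v_def mult_add_distrib_mat_vec[of _ n n] mult_mat_vec[of _ n n])
    ultimately have "(unit_vec n 1 + c \<cdot>\<^sub>v unit_vec n 0) $ 1 = (0\<^sub>v n :: real vec) $ 1" by simp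
    then show False using n by simp
  qed
  then have vv': "v' \<bullet> v' > 0" using v' by (blast intro: scalar_prod_self_pos)
  have Av': "A *\<^sub>v v' = m \<cdot>\<^sub>v v' + (b + c * l - m * c) \<cdot>\<^sub>v u"
  proof -
    have "A *\<^sub>v v' = A *\<^sub>v v + c \<cdot>\<^sub>v (A *\<^sub>v u)"
      using A u v by (simp add: v'_def mult_add_distrib_mat_vec[of _ n n] mult_mat_vec[of _ n n])
    then show ?thesis
      using u v by (intro eq_vecI) (auto simp: Au Av v'_def algebra_simps)
  qed
  have "v' \<bullet> (A *\<^sub>v u) = (A *\<^sub>v v') \<bullet> u"
    using transpose_vec_mult_scalar[OF A u v'] sym by simp
  text \<open>Symmetry removes the off-diagonal entry, so that \<open>v'\<close> is an eigenvector too.\<close>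
  then have "(b + c * l - m * c) * (u \<bullet> u) = 0"
    using u v' uv' comm_scalar_prod[OF u v']
    by (simp add: Au Av' add_scalar_prod_distrib[of _ n])
  then have Av'': "A *\<^sub>v v' = m \<cdot>\<^sub>v v'" using Av' uu u v' by auto
  \<comment> \<open>A nonzero combination orthogonal to \<open>w\<close>: \<open>u\<close> itself if
    it qualifies, otherwise \<open>v'\<close> corrected by a multiple of \<open>u\<close>.\<close>
  define s where "s = (if w \<bullet> u = 0 then 1 else - (w \<bullet> v') / (w \<bullet> u))"
  define t where "t = (if w \<bullet> u = 0 then 0 else 1 :: real)"
  define x where "x = s \<cdot>\<^sub>v u + t \<cdot>\<^sub>v v'"
  have x: "x \<in> carrier_vec n" using u v' by (simp add: x_def)
  have q: "(s \<cdot>\<^sub>v u + t \<cdot>\<^sub>v v') \<bullet> (g \<cdot>\<^sub>v u + h \<cdot>\<^sub>v v') = s * g * (u \<bullet> u) + t * h * (v' \<bullet> v')" for g h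
    using u v' uv' comm_scalar_prod[OF u v']
    by (simp add: add_scalar_prod_distrib[of _ n] scalar_prod_add_distrib[of _ n])
  have "x \<bullet> x > 0"
    using uu vv' unfolding x_def q by (auto simp: s_def t_def intro: add_nonneg_pos)
  then have "x \<noteq> 0\<^sub>v n" by auto
  moreover have "w \<bullet> x = 0"
    using u v' w by (auto simp: x_def s_def t_def scalar_prod_add_distrib[of _ n])
  moreover have "x \<bullet> (A *\<^sub>v x) \<ge> 0"
  proof -
    have Ax: "A *\<^sub>v x = (l * s) \<cdot>\<^sub>v u + (m * t) \<cdot>\<^sub>v v'"
      using A u v' by (simp add: x_def mult_add_distrib_mat_vec[of _ n n] mult_mat_vec[of _ n n]
        Au Av'' smult_smult_assoc mult.commute)
    have "x \<bullet> (A *\<^sub>v x) = l * (s * s) * (u \<bullet> u) + m * (t * t) * (v' \<bullet> v')"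
      unfolding Ax unfolding x_def q by simp
    then show ?thesis using uu vv' pos by simp
  qed
  ultimately show ?thesis using x that by blast
qed

text \<open>The determinant excludes the root 0, and its sign excludes \<open>n\<close> negative
  roots, whose product would have sign \<open>(- 1) ^ n\<close>. Negativity on the vectors
  orthogonal to \<open>w\<close> excludes two positive roots.\<close>

lemma inertia_one_positive:
  fixes A :: "real mat" and w :: "real vec"
  assumes A: "A \<in> carrier_mat n n" and sym: "A\<^sup>T = A" and w: "w \<in> carrier_vec n" and "0 < n"
    and neg: "\<And>x. x \<in> carrier_vec n \<Longrightarrow> x \<noteq> 0\<^sub>v n \<Longrightarrow> w \<bullet> x = 0 \<Longrightarrow> x \<bullet> (A *\<^sub>v x) < 0"
    and det: "(- 1) ^ (n - 1) * det A > 0"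
  shows "inertia A = (1, n - 1, 0)"
proof -
  obtain es where es: "char_poly A = (\<Prod>e\<leftarrow>es. [:- e, 1:])" "length es = n"
    using real_symmetric_char_poly_splits[OF A sym] .
  define E where "E = mset es"
  define P where "P = {#x \<in># E. x > 0#}"
  define N where "N = {#x \<in># E. x < 0#}"
  have detE: "det A = prod_mset E"
    using det_eq_prod_list_roots[OF A es(1)] by (simp add: E_def prod_mset_prod_list)
  have "0 \<notin># E" using det by (auto simp: detE dest!: multi_member_split)
  then have Z: "{#x \<in># E. x = 0#} = {#}" by (auto simp: filter_mset_eq_conv)
  have E: "E = P + N"
    unfolding P_def N_def using \<open>0 \<notin># E\<close>
    by (subst multiset_partition[of E "\<lambda>x. x > 0"])
       (auto intro!: filter_mset_cong simp: not_less order_le_less)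
  have size: "size P + size N = n" using es(2) arg_cong[OF E, of size] by (simp add: E_def)
  have pos: "prod_mset P > 0" unfolding P_def by (induction E) auto
  have "(- 1) ^ size N * prod_mset N > 0" unfolding N_def
    by (induction E) (auto simp: mult_less_0_iff zero_less_mult_iff)
  have "size P \<noteq> 0"
  proof
    assume "size P = 0"
    then have "det A = prod_mset N" "size N = n" using detE E size by auto
    then have "(- 1) ^ n * det A > 0" using \<open>(- 1) ^ size N * prod_mset N > 0\<close> by simp
    then show False using det \<open>0 < n\<close> by (cases n) auto
  qed
  moreover have "size P \<le> 1"
  proof (rule ccontr)
    assume "\<not> size P \<le> 1"
    then obtain l P' where l: "P = add_mset l P'" "size P' \<noteq> 0"
      by (cases P) auto
    then obtain m P'' where m: "P' = add_mset m P''" by (cases P') auto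
    obtain fs where fs: "mset fs = P'' + N" using ex_mset by blast
    have "l \<in># P" "m \<in># P" using l m by auto
    then have "l > 0" "m > 0" by (auto simp: P_def)
    \<comment> \<open>The roots are reordered so that two positive ones come first, as the Schur
      argument requires.\<close>
    have perm: "mset es = mset (l # m # fs)" using E l m fs by (simp add: E_def)
    have "char_poly A = (\<Prod>e\<leftarrow>l # m # fs. [:- e, 1:])"
      unfolding es(1) by (simp only: prod_mset_prod_list[symmetric] mset_map perm)
    from two_positive_roots_imp_nonneg[OF A sym w this \<open>l > 0\<close> \<open>m > 0\<close>]
    obtain x where "x \<in> carrier_vec n" "x \<noteq> 0\<^sub>v n" "w \<bullet> x = 0" "x \<bullet> (A *\<^sub>v x) \<ge> 0" .
    then show False using neg[of x] by simp
  qed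
  ultimately have "size P = 1" by linarith
  moreover have "proots (char_poly A) = E" by (simp add: es(1) proots_prod_list_linear E_def)
  ultimately show ?thesis using size Z by (simp add: inertia_def P_def N_def)
qed

section \<open>Determinants from consecutive row differences\<close>

text \<open>\<open>L\<close> subtracts from each row its parent row, and \<open>C\<close> replaces
  each column by the sum of the columns from it onwards. Both have determinant 1, and
  \<open>L * A * C\<close> is upper triangular.\<close>

lemma det_consecutive_row_differences:
  fixes A :: "'a :: comm_ring_1 mat" and r :: "nat \<Rightarrow> nat"
  assumes A: "A \<in> carrier_mat n n" and n: "0 < n"
    and r: "\<And>k. k \<in> {1..<n} \<Longrightarrow> r k < k"
    and diff: "\<And>k j. k \<in> {1..<n} \<Longrightarrow> j < n \<Longrightarrow>
      A $$ (k, j) - A $$ (r k, j) = t k * (of_bool (j = k) - of_bool (j = k - 1))"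
  shows "det A = (\<Sum>j<n. A $$ (0, j)) * (\<Prod>k = 1..<n. t k)"
proof -
  define L where "L = mat n n (\<lambda>(k, i). of_bool (i = k) - of_bool (0 < k \<and> i = r k) :: 'a)"
  define C where "C = mat n n (\<lambda>(i, j). of_bool (j \<le> i) :: 'a)"
  have L: "L \<in> carrier_mat n n" and C: "C \<in> carrier_mat n n" by (simp_all add: L_def C_def)
  have "det L = prod_list (diag_mat L)"
  proof (rule det_lower_triangular[OF _ L])
    fix i j assume "i < j" "j < n"
    then show "L $$ (i, j) = 0" using r[of i] by (auto simp: L_def)
  qed
  also have "\<dots> = (\<Prod>k = 0..<n. 1)"
    unfolding prod_list_diag_prod
  proof (intro prod.cong)
    fix k assume "k \<in> {0..<n}"
    then show "L $$ (k, k) = 1" using L r[of k] by (cases "k = 0") (auto simp: L_def)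
  qed (use L in simp)
  finally have detL: "det L = 1" by simp
  have "det C = prod_list (diag_mat C)"
    by (rule det_lower_triangular[OF _ C]) (simp add: C_def)
  also have "\<dots> = (\<Prod>k = 0..<n. 1)"
    unfolding prod_list_diag_prod using C by (intro prod.cong) (auto simp: C_def)
  finally have detC: "det C = 1" by simp
  have delta: "(\<Sum>i = 0..<n. of_bool (i = l) * f i) = f l" if "l < n" for l and f :: "nat \<Rightarrow> 'a"
    using that by (simp add: of_bool_def if_distrib[where f = "\<lambda>x. x * _"] cong: if_cong)
  have mult: "(M * N) $$ (k, j) = (\<Sum>i = 0..<n. M $$ (k, i) * N $$ (i, j))"
    if "M \<in> carrier_mat n n" "N \<in> carrier_mat n n" "k < n" "j < n" for M N :: "'a mat" and k j
    using that by (auto simp: scalar_prod_def)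
  have LA: "(L * A) $$ (k, j) = (if k = 0 then A $$ (0, j) else t k * (of_bool (j = k) - of_bool (j = k - 1)))"
    if "k < n" "j < n" for k j
  proof -
    have "(L * A) $$ (k, j) = (\<Sum>i = 0..<n. L $$ (k, i) * A $$ (i, j))"
      using that by (rule mult[OF L A])
    also have "\<dots> = (\<Sum>i = 0..<n. of_bool (i = k) * A $$ (i, j)) -
        (\<Sum>i = 0..<n. of_bool (0 < k \<and> i = r k) * A $$ (i, j))"
      using that unfolding sum_subtractf[symmetric]
      by (intro sum.cong) (auto simp: L_def algebra_simps)
    also have "(\<Sum>i = 0..<n. of_bool (i = k) * A $$ (i, j)) = A $$ (k, j)"
      by (rule delta[OF that(1)])
    also have "(\<Sum>i = 0..<n. of_bool (0 < k \<and> i = r k) * A $$ (i, j)) = of_bool (0 < k) * A $$ (r k, j)"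
      using that r[of k] delta[of "r k" "\<lambda>i. A $$ (i, j)"] by (cases "k = 0") auto
    finally show ?thesis using diff[of k j] that by (cases "k = 0") auto
  qed
  \<comment> \<open>In a difference row the sums from \<open>j\<close> on cancel unless
    \<open>j = k\<close>; in row 0 the entry at \<open>j = 0\<close> is the full row sum.\<close>
  have LAC: "(L * A * C) $$ (k, j) = (if k = 0 then \<Sum>i = j..<n. A $$ (0, i) else t k * of_bool (j = k))"
    if "k < n" "j < n" for k j
  proof -
    have "(L * A * C) $$ (k, j) = (\<Sum>i = 0..<n. (L * A) $$ (k, i) * C $$ (i, j))"
      using that by (rule mult[OF mult_carrier_mat[OF L A] C])
    also have "\<dots> = (\<Sum>i = 0..<n. (L * A) $$ (k, i) * of_bool (j \<le> i))"
      using that by (intro sum.cong) (auto simp: C_def)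
    also have "\<dots> = (\<Sum>i = j..<n. (L * A) $$ (k, i))"
      using that by (intro sum.mono_neutral_cong_right) auto
    also have "\<dots> = (if k = 0 then \<Sum>i = j..<n. A $$ (0, i) else t k * of_bool (j = k))"
    proof (cases "k = 0")
      case False
      have "(\<Sum>i = j..<n. (L * A) $$ (k, i)) =
          t k * ((\<Sum>i = j..<n. of_bool (i = k)) - (\<Sum>i = j..<n. of_bool (i = k - 1)))"
        unfolding sum_subtractf[symmetric] sum_distrib_left
        using False that by (intro sum.cong) (auto simp: LA)
      also have "\<dots> = t k * (of_bool (j \<le> k) - of_bool (j \<le> k - 1))"
        using that by (auto simp: of_bool_def)
      finally show ?thesis using False by (auto simp: of_bool_def)
    qed (use that in \<open>auto simp: LA intro!: sum.cong\<close>)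
    finally show ?thesis .
  qed
  have LACc: "L * A * C \<in> carrier_mat n n" using L A C by simp
  have "det (L * A * C) = prod_list (diag_mat (L * A * C))"
    by (rule det_upper_triangular[OF _ LACc]) (use LACc in \<open>auto simp: LAC simp del: index_mult_mat\<close>)
  also have "\<dots> = (\<Prod>k = 0..<n. if k = 0 then \<Sum>i = 0..<n. A $$ (0, i) else t k)"
    unfolding prod_list_diag_prod using LACc
    by (intro prod.cong) (auto simp: LAC simp del: index_mult_mat)
  also have "\<dots> = (\<Sum>i = 0..<n. A $$ (0, i)) * (\<Prod>k = 1..<n. t k)"
    using n by (simp add: prod.atLeast_Suc_lessThan)
  finally show ?thesis
    using L A C detL detC by (simp add: det_mult[of _ n] atLeast0LessThan)
qed

section \<open>Distances in clique paths\<close>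

text \<open>\<open>f\<close> grows by at most 1 along an arc and starts at 0, so no walk to
  \<open>v\<close> is shorter than \<open>f v\<close>; the walk \<open>p\<close> attains this
  bound.\<close>

lemma (in pair_wf_digraph) graph_dist_eqI:
  fixes f :: "'a \<Rightarrow> nat"
  assumes f0: "f u = 0" and lip: "\<And>v w. (v, w) \<in> parcs G \<Longrightarrow> f w \<le> f v + 1"
    and p: "awalk u p v" "length p = f v"
  shows "graph_dist G u v = f v"
proof -
  have cost: "awalk_cost (\<lambda>_. 1) q = real (length q)" for q :: "('a \<times> 'a) list"
    by (induction q) auto
  have bound: "f v \<le> f x + length q" if "awalk x q v" for x q
    using that
  proof (induction q arbitrary: x)
    case (Cons e q)
    then have "(x, snd e) \<in> parcs G" "f v \<le> f (snd e) + length q"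
      by (auto simp: awalk_Cons_iff)
    then show ?case using lip[of x "snd e"] by simp
  qed (simp add: awalk_Nil_iff)
  have "\<mu> (\<lambda>_. 1) u v = ereal (f v)"
    unfolding \<mu>_def cost
  proof (rule INF_eqI)
    fix q assume "q \<in> {q. awalk u q v}"
    then show "ereal (f v) \<le> ereal (length q)" using bound[of u q] f0 by simp
  next
    fix y assume "\<And>q. q \<in> {q. awalk u q v} \<Longrightarrow> y \<le> ereal (length q)"
    then show "y \<le> ereal (f v)" using p by (metis mem_Collect_eq)
  qed
  then show ?thesis by (simp add: graph_dist_def)
qed

text \<open>The first alternative of \<open>step\<close> is a term 2: \<open>k\<close> opens a block
  over the edge between \<open>r k\<close> and \<open>k - 1\<close>, and membership in
  \<open>H\<close> switches. The second is a term one larger than its predecessor: \<open>k\<close>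
  becomes an adjacent twin of \<open>k - 1\<close> and inherits its membership.\<close>

locale clique_path =
  fixes n :: nat and W :: "nat \<Rightarrow> nat set" and r :: "nat \<Rightarrow> nat" and H :: "nat set"
  assumes n: "2 \<le> n" and H: "H \<subseteq> {1..n}" "1 \<notin> H" "2 \<in> H"
    and W1: "W 1 = {}" and W2: "W 2 = {1}" and r2: "r 2 = 1"
    and step: "k \<in> {3..n} \<Longrightarrow>
      r k \<in> W (k - 1) \<and> W k = {r k, k - 1} \<and> (k \<in> H \<longleftrightarrow> k - 1 \<notin> H) \<or>
      r k = k - 1 \<and> W k = insert (k - 1) (W (k - 1)) \<and> (k \<in> H \<longleftrightarrow> k - 1 \<in> H)"
begin

lemma vertex_cases [consumes 1, case_names second glue twin]:
  assumes "k \<in> {2..n}"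
  obtains "k = 2"
  | "k \<in> {3..n}" "r k \<in> W (k - 1)" "W k = {r k, k - 1}" "k \<in> H \<longleftrightarrow> k - 1 \<notin> H"
  | "k \<in> {3..n}" "r k = k - 1" "W k = insert (k - 1) (W (k - 1))" "k \<in> H \<longleftrightarrow> k - 1 \<in> H"
  using assms step[of k] by (cases "k = 2") auto

lemma W_bounds: "k \<in> {1..n} \<Longrightarrow> i \<in> W k \<Longrightarrow> i \<in> {1..<k}"
proof (induction k arbitrary: i rule: less_induct)
  case (less k)
  show ?case
  proof (cases "k = 1")
    case True
    then show ?thesis using less.prems W1 by simp
  next
    case False
    then have "k \<in> {2..n}" using less.prems by auto
    then show ?thesis
    proof (cases rule: vertex_cases)
      case second
      then show ?thesis using less.prems by (simp add: W2)
    next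
      case glue
      then have "r k \<in> {1..<k - 1}" by (intro less.IH) auto
      then show ?thesis using less.prems glue(1,3) by auto
    next
      case twin
      have "i = k - 1 \<or> i \<in> W (k - 1)" using less.prems twin(3) by auto
      moreover have "i \<in> {1..<k - 1}" if "i \<in> W (k - 1)"
        using that twin(1) by (intro less.IH) auto
      ultimately show ?thesis using twin(1) by auto
    qed
  qed
qed

lemma glue_less: "k \<in> {3..n} \<Longrightarrow> r k \<in> W (k - 1) \<Longrightarrow> r k \<in> {1..<k - 1}"
  by (rule W_bounds) auto

lemma r_less:
  assumes "k \<in> {2..n}"
  shows "r k \<in> {1..<k}"
  using assms
proof (cases rule: vertex_cases)
  case glue
  then show ?thesis using glue_less[of k] by auto
qed (auto simp: r2)

section \<open>Exchange sets attached to the vertices\<close>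

fun S :: "nat \<Rightarrow> nat set" where
  "S k = (if 2 \<le> k \<and> r k < k then transpose (k - 1) k ` S (r k) else H)"

declare S.simps [simp del]

lemma S_1: "S 1 = H"
  by (simp add: S.simps)

text \<open>The guard \<open>r k < k\<close> in the recursion secures termination;
  \<open>r_less\<close> discharges it at every vertex from 2 on.\<close>

lemma S_step: "k \<in> {2..n} \<Longrightarrow> S k = transpose (k - 1) k ` S (r k)"
  using r_less[of k] by (subst S.simps) auto

lemma mem_S_step: "k \<in> {2..n} \<Longrightarrow> x \<in> S k \<longleftrightarrow> transpose (k - 1) k x \<in> S (r k)"
  by (auto simp: S_step image_iff) (metis transpose_involutory)

text \<open>Building \<open>S i\<close> exchanges only elements up to \<open>i\<close>, so larger
  elements keep their status from \<open>H\<close>.\<close>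

lemma S_above: "1 \<le> i \<Longrightarrow> i < k \<Longrightarrow> k \<le> n \<Longrightarrow> k \<in> S i \<longleftrightarrow> k \<in> H"
proof (induction i rule: less_induct)
  case (less i)
  show ?case
  proof (cases "i = 1")
    case True
    then show ?thesis using S_1 by simp
  next
    case False
    then have i: "i \<in> {2..n}" using less.prems by auto
    have "transpose (i - 1) i k = k" using less.prems by (intro transpose_apply_other) auto
    then have "k \<in> S i \<longleftrightarrow> k \<in> S (r i)" using mem_S_step[OF i, of k] by simp
    then show ?thesis using less r_less[OF i] by auto
  qed
qed

text \<open>The exchange hands to \<open>k\<close> the status of \<open>k - 1\<close> in the
  parent's set. In a glue step the parent precedes \<open>k - 1\<close>, so this is the status in
  \<open>H\<close>, opposite to that of \<open>k\<close>; in a twin step the parent is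
  \<open>k - 1\<close> and induction applies.\<close>

lemma S_diagonal: "k \<in> {2..n} \<Longrightarrow> k \<in> S k \<longleftrightarrow> k \<notin> H"
proof (induction k rule: less_induct)
  case (less k)
  have eq: "k \<in> S k \<longleftrightarrow> k - 1 \<in> S (r k)" using mem_S_step[OF less.prems, of k] by simp
  from less.prems show ?case
  proof (cases rule: vertex_cases)
    case second
    then show ?thesis using eq H S_1 by (simp add: r2)
  next
    case glue
    have "r k \<in> {1..<k - 1}" using glue(1,2) by (rule glue_less)
    then have "k - 1 \<in> S (r k) \<longleftrightarrow> k - 1 \<in> H" using glue(1) by (intro S_above) auto
    then show ?thesis using eq glue(4) by blast
  next
    case twin
    have "k - 1 \<in> S (k - 1) \<longleftrightarrow> k - 1 \<notin> H" using twin(1) by (intro less.IH) auto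
    then show ?thesis using eq twin(2,4) by simp
  qed
qed

text \<open>Exactly one of \<open>k - 1\<close> and \<open>k\<close> lies in the parent's set, so
  the exchange moves exactly one element. This gives both distance 1 to the parent and the sign of
  the row difference.\<close>

lemma S_parent:
  assumes "k \<in> {2..n}"
  shows "k \<in> S (r k) \<longleftrightarrow> k \<in> H" "k - 1 \<in> S (r k) \<longleftrightarrow> k \<notin> H"
proof -
  show "k \<in> S (r k) \<longleftrightarrow> k \<in> H" using r_less[OF assms] assms by (intro S_above) auto
  show "k - 1 \<in> S (r k) \<longleftrightarrow> k \<notin> H" using S_diagonal[OF assms] mem_S_step[OF assms, of k] by simp
qed

lemma S_eq:
  assumes "k \<in> {2..n}"
  shows "S k = (if k \<in> H then insert (k - 1) (S (r k) - {k}) else insert k (S (r k) - {k - 1}))"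
proof (rule Set.set_eqI)
  fix x
  have "k - 1 \<noteq> k" using assms by auto
  then show "x \<in> S k \<longleftrightarrow>
      x \<in> (if k \<in> H then insert (k - 1) (S (r k) - {k}) else insert k (S (r k) - {k - 1}))"
    using S_parent[OF assms] mem_S_step[OF assms, of x]
    by (cases "x = k"; cases "x = k - 1") simp_all
qed

lemma S_bounds: "k \<in> {1..n} \<Longrightarrow> S k \<subseteq> {1..n} \<and> card (S k) = card H"
proof (induction k rule: less_induct)
  case (less k)
  show ?case
  proof (cases "k = 1")
    case True
    then show ?thesis using S_1 H by simp
  next
    case False
    then have k: "k \<in> {2..n}" using less.prems by auto
    then have IH: "S (r k) \<subseteq> {1..n}" "card (S (r k)) = card H" using less r_less[OF k] by auto
    have "card (S k) = card (S (r k))"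
      unfolding S_step[OF k] by (intro card_image inj_on_subset[OF inj_transpose]) simp
    moreover have "S k \<subseteq> {1..n}" using IH(1) k unfolding S_eq[OF k] by auto
    ultimately show ?thesis using IH by simp
  qed
qed

lemma finite_S: "k \<in> {1..n} \<Longrightarrow> finite (S k)"
  using S_bounds[of k] by (auto intro: finite_subset)

section \<open>The distance function given by set differences\<close>

definition d :: "nat \<Rightarrow> nat \<Rightarrow> nat" where
  "d u v = card (S u - S v)"

lemma d_refl [simp]: "d u u = 0"
  by (simp add: d_def)

text \<open>All exchange sets have size \<open>card H\<close>, so either difference has this size
  minus that of the intersection.\<close>

lemma d_sym:
  assumes "u \<in> {1..n}" "v \<in> {1..n}"
  shows "d u v = d v u"
  using assms S_bounds[of u] S_bounds[of v] finite_S[of u] finite_S[of v]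
  by (simp add: d_def card_Diff_subset_Int Int_commute)

lemma d_triangle:
  assumes "u \<in> {1..n}" "v \<in> {1..n}"
  shows "d u w \<le> d u v + d v w"
proof -
  have "d u w \<le> card ((S u - S v) \<union> (S v - S w))"
    unfolding d_def using assms finite_S by (intro card_mono) auto
  also have "\<dots> \<le> d u v + d v w" unfolding d_def by (rule card_Un_le)
  finally show ?thesis .
qed

lemma d_parent:
  assumes k: "k \<in> {2..n}"
  shows "d k (r k) = 1"
proof -
  have "S k - S (r k) = (if k \<in> H then {k - 1} else {k})"
    using S_parent[OF k] k unfolding S_eq[OF k] by auto
  then show ?thesis by (simp add: d_def)
qed

text \<open>By \<open>S_above\<close> exactly one of \<open>k - 1\<close> and \<open>k\<close> lies
  in \<open>S i\<close>. The element the exchange brings in is the one outside \<open>S i\<close>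
  and is counted; the one it removes lies in \<open>S i\<close> and was not counted before.\<close>

lemma d_glue:
  assumes k: "k \<in> {3..n}" "r k \<in> W (k - 1)" "k \<in> H \<longleftrightarrow> k - 1 \<notin> H" and i: "i \<in> {1..<k - 1}"
  shows "d k i = d (r k) i + 1"
proof -
  have k2: "k \<in> {2..n}" using k(1) by auto
  have bounds: "1 \<le> i" "i < k" "k \<le> n" "i < k - 1" "k - 1 \<le> n" using k(1) i by auto
  have "k \<in> S i \<longleftrightarrow> k \<in> H" "k - 1 \<in> S i \<longleftrightarrow> k \<notin> H"
    using S_above[OF bounds(1,2,3)] S_above[OF bounds(1,4,5)] k(3) by blast+
  then have "S k - S i = insert (if k \<in> H then k - 1 else k) (S (r k) - S i)"
    using S_parent[OF k2] unfolding S_eq[OF k2] by auto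
  moreover have "(if k \<in> H then k - 1 else k) \<notin> S (r k) - S i"
    using S_parent[OF k2] by auto
  moreover have "finite (S (r k) - S i)" using r_less[OF k2] k2 finite_S[of "r k"] by auto
  ultimately show ?thesis by (simp add: d_def)
qed

text \<open>\<open>S i\<close> contains both or neither of \<open>k - 1\<close> and
  \<open>k\<close>, so the exchange fixes \<open>S i\<close> and maps one difference bijectively
  onto the other.\<close>

lemma d_twin:
  assumes k: "k \<in> {3..n}" "r k = k - 1" "k \<in> H \<longleftrightarrow> k - 1 \<in> H" and i: "i \<in> {1..<k - 1}"
  shows "d k i = d (k - 1) i"
proof -
  let ?t = "transpose (k - 1) k"
  have bounds: "1 \<le> i" "i < k" "k \<le> n" "i < k - 1" "k - 1 \<le> n" using k(1) i by auto
  have "k \<in> S i \<longleftrightarrow> k - 1 \<in> S i"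
    using S_above[OF bounds(1,2,3)] S_above[OF bounds(1,4,5)] k(3) by blast
  then have "?t ` S i = S i" by simp
  then have "S k - S i = ?t ` (S (k - 1) - S i)"
    using k(1,2) by (simp add: S_step image_set_diff[OF inj_transpose])
  then show ?thesis
    unfolding d_def by (simp add: card_image[OF inj_on_subset[OF inj_transpose]])
qed

lemma d_adjacent: "k \<in> {2..n} \<Longrightarrow> i \<in> W k \<Longrightarrow> d k i = 1"
proof (induction k arbitrary: i rule: less_induct)
  case (less k)
  from less.prems(1) show ?case
  proof (cases rule: vertex_cases)
    case second
    then show ?thesis using less.prems d_parent[of k] by (simp add: W2 r2)
  next
    case glue
    have k: "k - 1 \<in> {1..n}" "r k \<in> {1..n}" "k - 1 \<in> {2..n}"
      using glue(1) r_less[OF less.prems(1)] by auto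
    \<comment> \<open>\<open>k\<close> forms a triangle with the older edge between
      \<open>r k\<close> and \<open>k - 1\<close>; induction on that edge controls the remaining
      pair \<open>k\<close>, \<open>k - 1\<close>.\<close>
    have "d (k - 1) (r k) = 1" using glue(1,2) by (intro less.IH) auto
    then have card: "card (S (r k) - S (k - 1)) = 1" using d_sym[OF k(1,2)] by (simp add: d_def)
    have "k \<in> S (k - 1) \<longleftrightarrow> k \<in> H" using glue(1) by (intro S_above) auto
    then have mem: "k - 1 \<in> S (k - 1) \<longleftrightarrow> k \<in> H" "k \<in> S (k - 1) \<longleftrightarrow> k \<in> H"
      using S_diagonal[OF k(3)] glue(4) by blast+
    \<comment> \<open>If \<open>k \<in> H\<close>, both exchanged elements lie in
      \<open>S (k - 1)\<close> and the difference stays the same. Otherwise the single element of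
      the difference is \<open>k - 1\<close>, and the exchange turns it into
      \<open>k\<close>.\<close>
    have "card (S k - S (k - 1)) = 1"
    proof (cases "k \<in> H")
      case True
      then have "S k - S (k - 1) = S (r k) - S (k - 1)"
        using mem unfolding S_eq[OF less.prems(1)] by auto
      then show ?thesis using card by simp
    next
      case False
      obtain x where x: "S (r k) - S (k - 1) = {x}" using card by (rule card_1_singletonE)
      moreover have "k - 1 \<in> S (r k) - S (k - 1)" using False mem S_parent[OF less.prems(1)] by auto
      ultimately have "S (r k) - S (k - 1) = {k - 1}" by auto
      then have "S k - S (k - 1) = {k}"
        using False mem unfolding S_eq[OF less.prems(1)] by auto
      then show ?thesis by simp
    qed
    then show ?thesis using less.prems(2) d_parent[OF less.prems(1)] glue(3) by (auto simp: d_def)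
  next
    case twin
    show ?thesis
    proof (cases "i = k - 1")
      case True
      then show ?thesis using d_parent[OF less.prems(1)] twin(2) by simp
    next
      case False
      then have i: "i \<in> W (k - 1)" using less.prems twin(3) by auto
      then have "i \<in> {1..<k - 1}" using twin(1) by (intro W_bounds) auto
      moreover have "d (k - 1) i = 1" using i twin(1) by (intro less.IH) auto
      ultimately show ?thesis using d_twin[OF twin(1,2,4)] by simp
    qed
  qed
qed

text \<open>This provides the first arc of a shortest walk to an older vertex. For a nonadjacent
  target, \<open>r k\<close> serves in a glue step, and in a twin step the neighbor that works for
  \<open>k - 1\<close> also works for \<open>k\<close>.\<close>

lemma d_decrease: "k \<in> {2..n} \<Longrightarrow> i \<in> {1..<k} \<Longrightarrow> \<exists>j\<in>W k. d k i = d j i + 1"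
proof (induction k rule: less_induct)
  case (less k)
  have adj: ?case if "i \<in> W k" using that d_adjacent[OF less.prems(1)] by (intro bexI[of _ i]) auto
  from less.prems(1) show ?case
  proof (cases rule: vertex_cases)
    case second
    then show ?thesis using less.prems by (intro adj) (auto simp: W2)
  next
    case glue
    show ?thesis
    proof (cases "i = k - 1")
      case True
      then show ?thesis using glue(3) by (intro adj) auto
    next
      case False
      then have "i \<in> {1..<k - 1}" using less.prems by auto
      then show ?thesis using d_glue[OF glue(1,2,4)] glue(3) by auto
    qed
  next
    case twin
    show ?thesis
    proof (cases "i = k - 1")
      case True
      then show ?thesis using twin(3) by (intro adj) auto
    next
      case False
      then have i: "i \<in> {1..<k - 1}" using less.prems by auto
      then obtain j where "j \<in> W (k - 1)" "d (k - 1) i = d j i + 1"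
        using less.IH[of "k - 1"] twin(1) by force
      then show ?thesis using d_twin[OF twin(1,2,4) i] twin(3) by auto
    qed
  qed
qed

section \<open>Walks that realize the distance function\<close>

abbreviation path_graph :: "nat pair_pre_digraph" where
  "path_graph \<equiv> graph_of n W"

lemma arc_iff: "(u, v) \<in> parcs path_graph \<longleftrightarrow> u \<in> {1..n} \<and> v \<in> W u \<or> v \<in> {1..n} \<and> u \<in> W v"
  by (auto simp: graph_of_def)

lemma arc_bounds:
  assumes "(u, v) \<in> parcs path_graph"
  shows "u \<in> {1..n}" "v \<in> {1..n}"
  using assms W_bounds[of u v] W_bounds[of v u] by (auto simp: arc_iff)

lemma pair_sym_digraph_path_graph: "pair_sym_digraph path_graph"
proof unfold_locales
  fix e assume "e \<in> parcs path_graph"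
  then show "fst e \<in> pverts path_graph" "snd e \<in> pverts path_graph"
    using arc_bounds[of "fst e" "snd e"] by (simp_all add: graph_of_def)
next
  have "sym (parcs path_graph)" by (rule symI) (auto simp: arc_iff)
  then show "symmetric (with_proj path_graph)" by (simp add: symmetric_def)
qed

lemma d_arc:
  assumes "(u, v) \<in> parcs path_graph"
  shows "d u v = 1"
proof -
  have W: "d k i = 1" if "k \<in> {1..n}" "i \<in> W k" for k i
  proof -
    have "k \<noteq> 1" using that W1 by auto
    then show ?thesis using that by (intro d_adjacent) auto
  qed
  show ?thesis
    using assms W[of u v] W[of v u] d_sym[of u v] arc_bounds[OF assms] by (auto simp: arc_iff)
qed

text \<open>Induction on the largest vertex allowed as an end: from it, \<open>d_decrease\<close>
  steps to an older vertex one closer to the target. A walk ending there is obtained by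
  reversal.\<close>

lemma exists_walk:
  "k \<le> n \<Longrightarrow> u \<in> {1..k} \<Longrightarrow> v \<in> {1..k} \<Longrightarrow>
    \<exists>p. pre_digraph.awalk (with_proj path_graph) u p v \<and> length p = d u v"
proof (induction k arbitrary: u v)
  case (Suc k)
  interpret pair_sym_digraph path_graph by (rule pair_sym_digraph_path_graph)
  have down: "\<exists>p. awalk (Suc k) p i \<and> length p = d (Suc k) i" if i: "i \<in> {1..k}" for i
  proof -
    have k: "Suc k \<in> {2..n}" using i Suc.prems by auto
    obtain j where j: "j \<in> W (Suc k)" "d (Suc k) i = d j i + 1"
      using d_decrease[OF k, of i] i by auto
    have "j \<in> {1..k}" using W_bounds[OF _ j(1)] k by auto
    then obtain p where p: "awalk j p i" "length p = d j i"
      using Suc.IH[of j i] Suc.prems i by auto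
    have "(Suc k, j) \<in> parcs path_graph" using j k by (simp add: arc_iff)
    then have "awalk (Suc k) ((Suc k, j) # p) i"
      using p arc_bounds by (simp add: awalk_Cons_iff)
    then show ?thesis using p j by (intro exI[of _ "(Suc k, j) # p"]) simp
  qed
  consider "u \<in> {1..k}" "v \<in> {1..k}" | "u = Suc k" "v = Suc k"
    | "u = Suc k" "v \<in> {1..k}" | "u \<in> {1..k}" "v = Suc k"
    using Suc.prems by force
  then show ?case
  proof cases
    case 1
    then show ?thesis using Suc by auto
  next
    case 2
    have "Suc k \<in> pverts path_graph" using Suc.prems by (simp add: graph_of_def)
    then show ?thesis using 2 by (intro exI[of _ "[]"]) (simp add: awalk_Nil_iff)
  next
    case 3
    then show ?thesis using down by simp
  next
    case 4
    then obtain p where p: "awalk v p u" "length p = d v u" using down by auto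
    then have "awalk u (rev_path p) v" by simp
    moreover have "length (rev_path p) = length p" by (induction p) auto
    moreover have "d v u = d u v" using Suc.prems by (intro d_sym) auto
    ultimately show ?thesis using p by metis
  qed
qed simp

text \<open>The triangle inequality and value 1 on arcs make \<open>d u\<close> a valid lower bound
  function for \<open>graph_dist_eqI\<close>.\<close>

lemma graph_dist_eq_d:
  assumes "u \<in> {1..n}" "v \<in> {1..n}"
  shows "graph_dist path_graph u v = d u v"
proof -
  interpret pair_sym_digraph path_graph by (rule pair_sym_digraph_path_graph)
  obtain p where "awalk u p v" "length p = d u v"
    using exists_walk[of n u v] assms by auto
  moreover have "d u y \<le> d u x + 1" if "(x, y) \<in> parcs path_graph" for x y
    using d_triangle[of u x y] d_arc[OF that] arc_bounds[OF that] assms by simp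
  ultimately show ?thesis by (intro graph_dist_eqI) auto
qed

subsection \<open>The distance matrix\<close>

abbreviation (input) "D \<equiv> distance_matrix path_graph"

definition X :: "real mat" where
  "X = mat n n (\<lambda>(i, j). of_bool (j + 1 \<in> S (i + 1)))"

definition Y :: "real mat" where
  "Y = mat n n (\<lambda>(i, j). of_bool (j + 1 \<notin> S (i + 1)))"

lemma XY_carrier [simp]: "X \<in> carrier_mat n n" "Y \<in> carrier_mat n n"
  by (simp_all add: X_def Y_def)

lemma D_eq: "D = mat n n (\<lambda>(i, j). real (d (i + 1) (j + 1)))"
proof -
  have "card (pverts path_graph) = n" by (simp add: graph_of_def)
  then show ?thesis
    unfolding distance_matrix_def by (intro eq_matI) (auto simp: graph_dist_eq_d)
qed

text \<open>An entry of the product counts the elements that lie in the set of the row vertex but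
  not in that of the column vertex, which is \<open>d\<close>.\<close>

lemma D_factor: "D = X * Y\<^sup>T"
proof (rule eq_matI)
  fix i j assume "i < dim_row (X * Y\<^sup>T)" "j < dim_col (X * Y\<^sup>T)"
  then have ij: "i < n" "j < n" by (simp_all add: X_def Y_def)
  have "(X * Y\<^sup>T) $$ (i, j) = (\<Sum>x = 0..<n. of_bool (x + 1 \<in> S (i + 1) - S (j + 1)))"
    using ij by (auto simp: X_def Y_def scalar_prod_def intro!: arg_cong[where f = card])
  also have "\<dots> = (\<Sum>x\<in>{1..n}. of_bool (x \<in> S (i + 1) - S (j + 1)))"
    by (rule sum.reindex_bij_witness[of _ "\<lambda>x. x - 1" Suc]) auto
  also have "\<dots> = real (card ({1..n} \<inter> (S (i + 1) - S (j + 1))))"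
    by (simp add: Int_def)
  also have "{1..n} \<inter> (S (i + 1) - S (j + 1)) = S (i + 1) - S (j + 1)"
    using S_bounds[of "i + 1"] ij by auto
  finally show "D $$ (i, j) = (X * Y\<^sup>T) $$ (i, j)" using ij by (simp add: D_eq d_def)
qed (simp_all add: D_eq X_def Y_def)

section \<open>Determinant of the distance matrix\<close>

lemma indicator_difference:
  assumes "k \<in> {2..n}"
  shows "of_bool (x \<in> S k) - of_bool (x \<in> S (r k)) =
    (if k \<in> H then - 1 else 1) * (of_bool (x = k) - of_bool (x = k - 1) :: real)"
proof -
  have "k - 1 \<noteq> k" using assms by auto
  then show ?thesis
    using S_parent[OF assms] unfolding S_eq[OF assms] by (cases "x = k"; cases "x = k - 1") simp_all
qed

text \<open>Sign of the difference in row \<open>k\<close>, which belongs to vertex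
  \<open>Suc k\<close>: it is negative when the exchange trades \<open>Suc k\<close> for
  \<open>k\<close>.\<close>

definition t :: "nat \<Rightarrow> real" where
  "t k = (if Suc k \<in> H then - 1 else 1)"

text \<open>Row 0 is the indicator of \<open>S 1 = H\<close>, whence the factor
  \<open>card H\<close>. The parent of row \<open>k\<close> is row \<open>r (Suc k) - 1\<close>,
  because vertices are numbered from 1.\<close>

lemma det_X: "det X = card H * (\<Prod>k = 1..<n. t k)"
proof -
  have "det X = (\<Sum>j<n. X $$ (0, j)) * (\<Prod>k = 1..<n. t k)"
  proof (rule det_consecutive_row_differences[where r = "\<lambda>k. r (Suc k) - 1"])
    fix k assume "k \<in> {1..<n}"
    then have k: "Suc k \<in> {2..n}" by auto
    have r: "r (Suc k) \<in> {1..<Suc k}" by (rule r_less[OF k])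
    then show "r (Suc k) - 1 < k" by auto
    fix j assume j: "j < n"
    have "r (Suc k) - 1 + 1 = r (Suc k)" using r by auto
    moreover have "j + 1 = Suc k \<longleftrightarrow> j = k" "j + 1 = Suc k - 1 \<longleftrightarrow> j = k - 1"
      using \<open>k \<in> {1..<n}\<close> by auto
    moreover have "r (Suc k) - 1 < n" "k < n" using r k by auto
    ultimately show "X $$ (k, j) - X $$ (r (Suc k) - 1, j) =
        t k * (of_bool (j = k) - of_bool (j = k - 1))"
      using indicator_difference[OF k, of "j + 1"] j by (simp add: X_def t_def)
  qed (use n in auto)
  also have "(\<Sum>j<n. X $$ (0, j)) = (\<Sum>j<n. of_bool (j + 1 \<in> H))"
    using n S_1 by (intro sum.cong) (auto simp: X_def)
  also have "\<dots> = (\<Sum>x\<in>{1..n}. of_bool (x \<in> H))"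
    by (rule sum.reindex_bij_witness[of _ "\<lambda>x. x - 1" Suc]) auto
  also have "\<dots> = real (card H)" using H by (simp add: Int_absorb1)
  finally show ?thesis .
qed

text \<open>Complementing the sets reverses every row difference and turns the sum of row 0 into the
  size of the complement of \<open>H\<close>.\<close>

lemma det_Y: "det Y = card ({1..n} - H) * (\<Prod>k = 1..<n. - t k)"
proof -
  have "det Y = (\<Sum>j<n. Y $$ (0, j)) * (\<Prod>k = 1..<n. - t k)"
  proof (rule det_consecutive_row_differences[where r = "\<lambda>k. r (Suc k) - 1"])
    fix k assume "k \<in> {1..<n}"
    then have k: "Suc k \<in> {2..n}" by auto
    have r: "r (Suc k) \<in> {1..<Suc k}" by (rule r_less[OF k])
    then show "r (Suc k) - 1 < k" by auto
    fix j assume j: "j < n"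
    have "r (Suc k) - 1 + 1 = r (Suc k)" using r by auto
    moreover have "j + 1 = Suc k \<longleftrightarrow> j = k" "j + 1 = Suc k - 1 \<longleftrightarrow> j = k - 1"
      using \<open>k \<in> {1..<n}\<close> by auto
    moreover have "r (Suc k) - 1 < n" "k < n" using r k by auto
    ultimately show "Y $$ (k, j) - Y $$ (r (Suc k) - 1, j) =
        - t k * (of_bool (j = k) - of_bool (j = k - 1))"
      using indicator_difference[OF k, of "j + 1"] j by (simp add: Y_def t_def of_bool_not_iff)
  qed (use n in auto)
  also have "(\<Sum>j<n. Y $$ (0, j)) = (\<Sum>j<n. of_bool (j + 1 \<in> {1..n} - H))"
    using n S_1 by (intro sum.cong) (auto simp: Y_def)
  also have "\<dots> = (\<Sum>x\<in>{1..n}. of_bool (x \<in> {1..n} - H))"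
    by (rule sum.reindex_bij_witness[of _ "\<lambda>x. x - 1" Suc]) auto
  also have "\<dots> = real (card ({1..n} - H))" by (simp add: set_diff_eq Int_def)
  finally show ?thesis .
qed

lemma det_D: "det D = (- 1) ^ (n - 1) * real (card H) * real (card ({1..n} - H))"
proof -
  \<comment> \<open>Each \<open>t k\<close> is a sign, so every nonzero row index contributes
    \<open>- (t k * t k) = - 1\<close>.\<close>
  have "(\<Prod>k = 1..<n. t k) * (\<Prod>k = 1..<n. - t k) = (\<Prod>k = 1..<n. - 1)"
    unfolding prod.distrib[symmetric] by (intro prod.cong) (auto simp: t_def)
  also have "\<dots> = (- 1) ^ (n - 1)" by simp
  finally have "det X * det Y = (- 1) ^ (n - 1) * real (card H) * real (card ({1..n} - H))"
    unfolding det_X det_Y by (simp add: mult.assoc mult.left_commute)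
  then show ?thesis by (simp add: D_factor det_mult[of _ n] det_transpose[of _ n])
qed

section \<open>Inertia of the distance matrix\<close>

lemma card_pos: "card H > 0" "card ({1..n} - H) > 0"
proof -
  have "finite H" using H finite_subset by blast
  then show "card H > 0" using H by (auto simp: card_gt_0_iff)
  show "card ({1..n} - H) > 0" using H n by (auto simp: card_gt_0_iff)
qed

lemma D_negative:
  assumes x: "x \<in> carrier_vec n" "x \<noteq> 0\<^sub>v n" "vec n (\<lambda>_. 1) \<bullet> x = 0"
  shows "x \<bullet> (D *\<^sub>v x) < 0"
proof -
  define z where "z = X\<^sup>T *\<^sub>v x"
  have z: "z \<in> carrier_vec n" using x unfolding z_def by (intro mult_mat_vec_carrier[of _ n n]) simp_all
  \<comment> \<open>Invertibility of \<open>X\<close> makes the form strictly negative and not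
    merely nonpositive.\<close>
  have "det (X\<^sup>T) \<noteq> 0" using card_pos by (simp add: det_transpose[of _ n] det_X t_def)
  then have "z \<noteq> 0\<^sub>v n"
    using det_0_iff_vec_prod_zero_field[of "X\<^sup>T" n] x by (auto simp: z_def)
  then have "z \<bullet> z > 0" using z by (blast intro: scalar_prod_self_pos)
  have sum: "(\<Sum>i = 0..<n. x $ i) = 0" using x by (simp add: scalar_prod_def)
  \<comment> \<open>\<open>X\<close> and \<open>Y\<close> add up to the all-ones matrix, whose
    transpose annihilates vectors with coordinate sum 0.\<close>
  have Yx: "Y\<^sup>T *\<^sub>v x = - z"
  proof (rule eq_vecI)
    fix j assume "j < dim_vec (- z)"
    then have j: "j < n" using z by simp
    have "(Y\<^sup>T *\<^sub>v x) $ j + z $ j = (\<Sum>i = 0..<n. x $ i)"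
      using j x(1) unfolding z_def
      by (simp add: X_def Y_def scalar_prod_def, subst sum.union_disjoint[symmetric])
         (auto intro!: sum.cong)
    then show "(Y\<^sup>T *\<^sub>v x) $ j = (- z) $ j" using j z sum by simp
  qed (use z in \<open>simp add: Y_def\<close>)
  have "x \<bullet> (D *\<^sub>v x) = x \<bullet> (X *\<^sub>v (Y\<^sup>T *\<^sub>v x))"
    using x by (simp add: D_factor assoc_mult_mat_vec[of _ n n _ n])
  also have "\<dots> = z \<bullet> (- z)"
    using transpose_vec_mult_scalar[of X n n "- z" x] x z by (simp add: Yx z_def)
  also have "\<dots> = - (z \<bullet> z)" using z by simp
  finally show ?thesis using \<open>z \<bullet> z > 0\<close> by simp
qed

lemma inertia_D: "inertia D = (1, n - 1, 0)"
proof (rule inertia_one_positive)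
  show "D \<in> carrier_mat n n" by (simp add: D_eq)
  show "D\<^sup>T = D" by (rule eq_matI) (auto simp: D_eq intro!: d_sym)
  show "vec n (\<lambda>_. 1) \<in> carrier_vec n" by simp
  show "0 < n" using n by simp
  show "(- 1) ^ (n - 1) * det D > 0"
    using card_pos by (simp add: det_D mult.assoc[symmetric] power_mult_distrib[symmetric])
qed (rule D_negative)

end

section \<open>Block sequences\<close>

text \<open>Induction on the number of blocks, adding a new block to \<open>H\<close> exactly when
  its index is even. The clause on the last vertex carries the alternation across the seam between
  blocks. The bound \<open>4 \<le> k\<close> keeps \<open>k - 1\<close> in the range where
  neighborhoods are given by an interval, and separates a genuine continuation from
  \<open>k = 3\<close>, where 2 also follows 1.\<close>

lemma two_colon_blocks:
  fixes p :: "nat \<Rightarrow> nat" and m :: nat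
  defines "s \<equiv> \<lambda>m. two_colon (map p [1..<m + 1])"
  assumes "\<And>k. k \<in> {1..m} \<Longrightarrow> 3 \<le> p k"
  shows "\<exists>H. H \<subseteq> {1..length (s m)} \<and> 1 \<notin> H \<and> 2 \<in> H \<and> (length (s m) \<in> H \<longleftrightarrow> even m) \<and>
    (\<forall>k\<in>{3..length (s m)}. term_of (s m) k = 2 \<and> (k \<in> H \<longleftrightarrow> k - 1 \<notin> H) \<or>
       4 \<le> k \<and> term_of (s m) k = term_of (s m) (k - 1) + 1 \<and> (k \<in> H \<longleftrightarrow> k - 1 \<in> H)) \<and>
    card H = 1 + (\<Sum>k | k \<in> {1..m} \<and> even k. p k - 2) \<and>
    card ({1..length (s m)} - H) = 1 + (\<Sum>k | k \<in> {1..m} \<and> odd k. p k - 2)"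
  using assms(2)
proof (induction m)
  case 0
  have "length (s 0) = 2" by (simp add: s_def two_colon_def)
  \<comment> \<open>Vertex 2 counts as if it belonged to an even block and vertex 1 to an odd one;
    they give the summand 1 in either size.\<close>
  moreover have "{1..2} - {2} = {1 :: nat}" by auto
  ultimately show ?case by (intro exI[of _ "{2}"]) simp
next
  case (Suc m)
  define N where "N = length (s m)"
  define q where "q = p (Suc m) - 2"
  have q: "1 \<le> q" "p (Suc m) = q + 2" using Suc.prems[of "Suc m"] by (auto simp: q_def)
  have eq: "s (Suc m) = s m @ [2..<p (Suc m)]" by (simp add: s_def two_colon_def)
  have len: "length (s (Suc m)) = N + q" by (simp add: eq N_def q_def)
  have N: "2 \<le> N" by (simp add: N_def s_def two_colon_def)
  obtain H where H: "H \<subseteq> {1..N}" "1 \<notin> H" "2 \<in> H" "N \<in> H \<longleftrightarrow> even m"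
    and old: "\<forall>k\<in>{3..N}. term_of (s m) k = 2 \<and> (k \<in> H \<longleftrightarrow> k - 1 \<notin> H) \<or>
       4 \<le> k \<and> term_of (s m) k = term_of (s m) (k - 1) + 1 \<and> (k \<in> H \<longleftrightarrow> k - 1 \<in> H)"
    and card: "card H = 1 + (\<Sum>k | k \<in> {1..m} \<and> even k. p k - 2)"
      "card ({1..N} - H) = 1 + (\<Sum>k | k \<in> {1..m} \<and> odd k. p k - 2)"
    using Suc unfolding N_def by auto
  have old_term: "term_of (s (Suc m)) k = term_of (s m) k" if "k \<in> {1..N}" for k
    using that by (auto simp: term_of_def eq nth_append N_def)
  have new_term: "term_of (s (Suc m)) (N + i) = i + 1" if "i \<in> {1..q}" for i
    using that q by (auto simp: term_of_def eq nth_append N_def)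
  define B where "B = {N + 1..N + q}"
  define H' where "H' = (if even (Suc m) then H \<union> B else H)"
  have H'_old: "k \<in> H' \<longleftrightarrow> k \<in> H" if "k \<le> N" for k using that by (auto simp: H'_def B_def)
  have H'_new: "k \<in> H' \<longleftrightarrow> even (Suc m)" if "k \<in> B" for k
    using that H(1) by (auto simp: H'_def B_def)
  have fin: "finite H" "finite B" using H(1) finite_subset by (blast, simp add: B_def)
  have disj: "H \<inter> B = {}" using H(1) by (auto simp: B_def)
  have split: "{k. k \<in> {1..Suc m} \<and> P k} = {k. k \<in> {1..m} \<and> P k} \<union> (if P (Suc m) then {Suc m} else {})" for P
    by (auto simp: le_Suc_eq)
  have even: "(\<Sum>k | k \<in> {1..Suc m} \<and> even k. p k - 2) =
      (\<Sum>k | k \<in> {1..m} \<and> even k. p k - 2) + (if even (Suc m) then q else 0)"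
    and odd: "(\<Sum>k | k \<in> {1..Suc m} \<and> odd k. p k - 2) =
      (\<Sum>k | k \<in> {1..m} \<and> odd k. p k - 2) + (if even (Suc m) then 0 else q)"
    unfolding split q_def by auto
  have "card H' = card H + (if even (Suc m) then q else 0)"
    using card_Un_disjoint[OF fin disj] by (simp add: H'_def B_def)
  moreover have "card ({1..N + q} - H') = card ({1..N} - H) + (if even (Suc m) then 0 else q)"
  proof -
    have "{1..N + q} - H' = ({1..N} - H) \<union> (if even (Suc m) then {} else B)"
      using disj by (auto simp: H'_def B_def)
    moreover have "({1..N} - H) \<inter> B = {}" by (auto simp: B_def)
    ultimately show ?thesis using card_Un_disjoint[of "{1..N} - H" B] by (auto simp: B_def)
  qed
  moreover have "H' \<subseteq> {1..N + q}" using H(1) by (auto simp: H'_def B_def)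
  moreover have "1 \<notin> H'" "2 \<in> H'" using H'_old[of 1] H'_old[of 2] H N by auto
  moreover have "N + q \<in> H' \<longleftrightarrow> even (Suc m)" using q by (intro H'_new) (simp add: B_def)
  moreover have "term_of (s (Suc m)) k = 2 \<and> (k \<in> H' \<longleftrightarrow> k - 1 \<notin> H') \<or>
       4 \<le> k \<and> term_of (s (Suc m)) k = term_of (s (Suc m)) (k - 1) + 1 \<and> (k \<in> H' \<longleftrightarrow> k - 1 \<in> H')"
    if k: "k \<in> {3..N + q}" for k
  proof -
    consider "k \<in> {3..N}" | "k = N + 1" | i where "k = N + i" "i \<in> {2..q}"
    proof -
      have "k \<in> {3..N} \<or> k = N + 1 \<or> (k = N + (k - N) \<and> k - N \<in> {2..q})" using k by auto
      then show ?thesis using that by blast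
    qed
    then show ?thesis
    proof cases
      case 1
      then have "k \<in> {1..N}" "k - 1 \<in> {1..N}" by auto
      then show ?thesis using old 1 old_term H'_old[of k] H'_old[of "k - 1"] by auto
    next
      case 2
      have "term_of (s (Suc m)) k = 2" using new_term[of 1] q 2 by simp
      moreover have "k \<in> H' \<longleftrightarrow> even (Suc m)" using q 2 by (intro H'_new) (simp add: B_def)
      \<comment> \<open>At the seam \<open>k - 1\<close> is the last old vertex, whose membership
        follows the previous parity.\<close>
      moreover have "k - 1 \<in> H' \<longleftrightarrow> even m" using H'_old[of N] H(4) 2 by simp
      ultimately show ?thesis by simp
    next
      case 3
      then have "term_of (s (Suc m)) k = i + 1" using new_term[of i] by simp
      moreover have "term_of (s (Suc m)) (k - 1) = i"
      proof -
        have "i - 1 \<in> {1..q}" "k - 1 = N + (i - 1)" "i - 1 + 1 = i" using 3 by auto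
        then show ?thesis using new_term[of "i - 1"] by metis
      qed
      moreover have "k \<in> H' \<longleftrightarrow> even (Suc m)" using 3 by (intro H'_new) (simp add: B_def)
      moreover have "k - 1 \<in> H' \<longleftrightarrow> even (Suc m)" using 3 by (intro H'_new) (auto simp: B_def)
      moreover have "4 \<le> k" using 3 N by simp
      ultimately show ?thesis by simp
    qed
  qed
  ultimately show ?case unfolding len even odd using card by (intro exI[of _ H']) auto
qed

lemma neighborhood_seq_glue:
  assumes W: "neighborhood_seq s W" and k: "k \<in> {3..length s}" "term_of s k = 2"
  obtains a where "a \<in> W (k - 1)" "W k = {a, k - 1}"
proof -
  obtain a where a: "a \<in> W (k - 1)" "W k = {a} \<union> {b_index s k..k - 1}"
    using W k(1) unfolding neighborhood_seq_def by blast
  have "b_index s k = k - 1" using k by (simp add: b_index_def)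
  then show ?thesis using a that[of a] by auto
qed

text \<open>A term growing by 1 gives \<open>b_index s k = b_index s (k - 1)\<close>. Only one
  element of \<open>W (k - 1)\<close> lies below this bound, so the choice of \<open>a\<close> is
  forced.\<close>

lemma neighborhood_seq_twin:
  assumes s: "non_leaping s" and W: "neighborhood_seq s W"
    and k: "k \<in> {4..length s}" "term_of s k = term_of s (k - 1) + 1"
  shows "W k = insert (k - 1) (W (k - 1))"
proof -
  let ?b = "b_index s k"
  have ks: "k \<in> {3..length s}" "k - 1 \<in> {3..length s}" using k(1) by auto
  obtain a where a: "a \<in> W (k - 1)" "a < ?b" "W k = {a} \<union> {?b..k - 1}"
    using W ks(1) unfolding neighborhood_seq_def by blast
  obtain a' where a': "a' < b_index s (k - 1)"
    "W (k - 1) = {a'} \<union> {b_index s (k - 1)..k - 1 - 1}"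
    using W ks(2) unfolding neighborhood_seq_def by blast
  have "2 \<le> term_of s k" using s ks(1) unfolding non_leaping_def by blast
  then have b: "?b \<le> k - 1" using ks(1) by (auto simp: b_index_def)
  have "b_index s (k - 1) = ?b" using k by (auto simp: b_index_def)
  then have a'': "W (k - 1) = {a'} \<union> {?b..k - 1 - 1}" using a'(2) by simp
  then have "a = a'" using a(1,2) by auto
  moreover have "{?b..k - 1} = insert (k - 1) {?b..k - 1 - 1}" using b ks(1) by auto
  ultimately show ?thesis using a(3) a'' by auto
qed

section \<open>Determinant and inertia for block sequences\<close>

theorem theorem4p5:
  fixes m n :: nat and p :: "nat \<Rightarrow> nat" and G :: "nat pair_pre_digraph"
  assumes "\<And>k. k \<in> {1..m} \<Longrightarrow> 3 \<le> p k"
    and "G \<in> CP (two_colon (map p [1..<m + 1]))"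
    and "n = card (pverts G)"
  shows "det (distance_matrix G) =
           (- 1) ^ (n - 1)
           * (1 + (\<Sum>k | k \<in> {1..m} \<and> odd k. (real (p k) - 2)))
           * (1 + (\<Sum>k | k \<in> {1..m} \<and> even k. (real (p k) - 2)))
       \<and> inertia (distance_matrix G) = (1, n - 1, 0)"
proof -
  define s where "s = two_colon (map p [1..<m + 1])"
  have s: "non_leaping s" unfolding s_def by (rule non_leaping_two_colon) (use assms(1) in auto)
  obtain W where W: "neighborhood_seq s W" and G: "G = graph_of (length s) W"
    using assms(2) by (auto simp: CP_def s_def)
  have len: "n = length s" using assms(3) by (simp add: G graph_of_def)
  obtain H where H: "H \<subseteq> {1..n}" "1 \<notin> H" "2 \<in> H"
    and pattern: "\<forall>k\<in>{3..n}. term_of s k = 2 \<and> (k \<in> H \<longleftrightarrow> k - 1 \<notin> H) \<or>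
       4 \<le> k \<and> term_of s k = term_of s (k - 1) + 1 \<and> (k \<in> H \<longleftrightarrow> k - 1 \<in> H)"
    and card: "card H = 1 + (\<Sum>k | k \<in> {1..m} \<and> even k. p k - 2)"
      "card ({1..n} - H) = 1 + (\<Sum>k | k \<in> {1..m} \<and> odd k. p k - 2)"
    using two_colon_blocks[of m p] assms(1) unfolding s_def[symmetric] len by blast
  have "\<forall>k\<in>{3..n}. \<exists>a.
      a \<in> W (k - 1) \<and> W k = {a, k - 1} \<and> (k \<in> H \<longleftrightarrow> k - 1 \<notin> H) \<or>
      a = k - 1 \<and> W k = insert (k - 1) (W (k - 1)) \<and> (k \<in> H \<longleftrightarrow> k - 1 \<in> H)"
  proof
    fix k assume k: "k \<in> {3..n}"
    then consider "term_of s k = 2" "k \<in> H \<longleftrightarrow> k - 1 \<notin> H"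
      | "k \<in> {4..n}" "term_of s k = term_of s (k - 1) + 1" "k \<in> H \<longleftrightarrow> k - 1 \<in> H"
      using pattern by fastforce
    then show "\<exists>a. a \<in> W (k - 1) \<and> W k = {a, k - 1} \<and> (k \<in> H \<longleftrightarrow> k - 1 \<notin> H) \<or>
      a = k - 1 \<and> W k = insert (k - 1) (W (k - 1)) \<and> (k \<in> H \<longleftrightarrow> k - 1 \<in> H)"
    proof cases
      case 1
      then show ?thesis using neighborhood_seq_glue[OF W, of k] k len by metis
    next
      case 2
      then show ?thesis using neighborhood_seq_twin[OF s W, of k] len by blast
    qed
  qed
  from bchoice[OF this] obtain r where r: "\<forall>k\<in>{3..n}.
      r k \<in> W (k - 1) \<and> W k = {r k, k - 1} \<and> (k \<in> H \<longleftrightarrow> k - 1 \<notin> H) \<or>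
      r k = k - 1 \<and> W k = insert (k - 1) (W (k - 1)) \<and> (k \<in> H \<longleftrightarrow> k - 1 \<in> H)" ..
  \<comment> \<open>The choice function is constrained only from 3 on; the parent of vertex 2 is set
    to 1 by hand.\<close>
  interpret clique_path n W "r(2 := 1)" H
  proof
    show "2 \<le> n" using s by (simp add: len non_leaping_def)
    show "W 1 = {}" "W 2 = {1}" using W by (simp_all add: neighborhood_seq_def)
    fix k assume "k \<in> {3..n}"
    then show "(r(2 := 1)) k \<in> W (k - 1) \<and> W k = {(r(2 := 1)) k, k - 1} \<and> (k \<in> H \<longleftrightarrow> k - 1 \<notin> H) \<or>
      (r(2 := 1)) k = k - 1 \<and> W k = insert (k - 1) (W (k - 1)) \<and> (k \<in> H \<longleftrightarrow> k - 1 \<in> H)"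
      using bspec[OF r, of k] by simp
  qed (use H in auto)
  \<comment> \<open>Since \<open>p k\<close> is at least 3, subtraction on the natural numbers
    agrees with real subtraction, so the sizes become the two factors.\<close>
  have "real (p k - 2) = real (p k) - 2" if "k \<in> {1..m}" for k
    using assms(1)[OF that] by simp
  then have "real (card H) = 1 + (\<Sum>k | k \<in> {1..m} \<and> even k. (real (p k) - 2))"
    and "real (card ({1..n} - H)) = 1 + (\<Sum>k | k \<in> {1..m} \<and> odd k. (real (p k) - 2))"
    unfolding card by (auto intro!: sum.cong)
  moreover have "G = path_graph" using G len by simp
  ultimately show ?thesis using det_D inertia_D by (simp add: mult.assoc mult.commute)
qed

end
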